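(* Let $(G,\upsilon,\varepsilon)$ be a weighted multigraph on $n$ vertices and let $e$ be a nonloop edge of $G$. Let $\lambda_1\le\dots\le\lambda_n$, $\mu_1\le\dots\le\mu_n$ and $\nu_1\le\dots\le\nu_{n-1}$ denote the weighted Laplacian eigenvalues (with multiplicity) of $(G,\upsilon,\varepsilon)$, $(G-e,\upsilon,\varepsilon)$ and $(G/e,\upsilon/e,\varepsilon)$, respectively. Then $$\mu_1\le\lambda_1\le\nu_1\le\mu_2\le\lambda_2\le\nu_2\le\dots\le\nu_{n-1}\le\mu_n\le\lambda_n,$$ i.e. $\mu_i\le\lambda_i$ for $1\le i\le n$ and $\lambda_i\le\nu_i\le\mu_{i+1}$ for $1\le i\le n-1$.
   Context: A graph is a finite multigraph with vertex set $V$ and edge set $E$ (loops and multiple edges allowed). A weighted multigraph $(G,\upsilon,\varepsilon)$ is a graph $G$ with vertex weights $\upsilon:V\to\mathbb R_{>0}$ and edge weights $\varepsilon:E\to\mathbb R_{>0}$. For $u,v\in V$, $\varepsilon(u,v)$ is the total edge weight between $u$ and $v$, with loops counted twice, and $d_{(G,\varepsilon)}(u)=\sum_{v\in V}\varepsilon(u,v)$. The combinatorial Laplacian is the $V\times V$ matrix $L_{(G,\varepsilon)}=D_{(G,\varepsilon)}-A_{(G,\varepsilon)}$, where $A_{(G,\varepsilon)}=(\varepsilon(u,v))_{u,v}$ and $D_{(G,\varepsilon)}$ is diagonal with entries $d_{(G,\varepsilon)}(v)$. The weighted Laplacian is $L_{(G,\upsilon,\varepsilon)}=W_\upsilon^{-1}L_{(G,\varepsilon)}$,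 where $W_\upsilon$ is the diagonal matrix with entries $\upsilon(v)$; it is self-adjoint for the inner product $\langle f,g\rangle=\sum_{v}f(v)g(v)\upsilon(v)$ on functions $V\to\mathbb R$, so its eigenvalues are real. $G-e$ is $G$ with the edge $e$ removed. $G/e$ is the graph obtained from $G$ by removing $e$ and identifying its two endpoints as a single vertex. The weight function $\upsilon/e$ gives the new vertex the sum of the $\upsilon$-weights of the two endpoints of $e$, and every other vertex its weight under $\upsilon$. Edge weights of remaining edges are inherited from $\varepsilon$. *)

theory Defs
  imports
    Complex_Main
    "HOL-Library.Uprod"
    "HOL-Library.Multiset"
    "HOL-Computational_Algebra.Polynomial"
    "Jordan_Normal_Form.Char_Poly"
begin

section \<open>Weighted multigraphs\<close>

text \<open>
  Edges are abstract objects with an unordered pair of ends, so parallel edges are distinct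
  elements of the edge set and a loop is an edge with ends \<open>Upair v v\<close>.
\<close>

record ('v, 'e) pre_multigraph =
  verts :: "'v set"
  edges :: "'e set"
  ends :: "'e \<Rightarrow> 'v uprod"

definition multigraph :: "('v, 'e) pre_multigraph \<Rightarrow> bool" where
  "multigraph G \<longleftrightarrow> finite (verts G) \<and> finite (edges G) \<and>
     (\<forall>f \<in> edges G. set_uprod (ends G f) \<subseteq> verts G)"

definition weighted_multigraph ::
    "('v, 'e) pre_multigraph \<Rightarrow> ('v \<Rightarrow> real) \<Rightarrow> ('e \<Rightarrow> real) \<Rightarrow> bool" where
  "weighted_multigraph G \<upsilon> \<epsilon> \<longleftrightarrow> multigraph G \<and>
     (\<forall>v \<in> verts G. \<upsilon> v > 0) \<and> (\<forall>f \<in> edges G. \<epsilon> f > 0)"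

definition nonloop_edge :: "('v, 'e) pre_multigraph \<Rightarrow> 'e \<Rightarrow> bool" where
  "nonloop_edge G e \<longleftrightarrow> e \<in> edges G \<and> proper_uprod (ends G e)"

definition delete_edge :: "('v, 'e) pre_multigraph \<Rightarrow> 'e \<Rightarrow> ('v, 'e) pre_multigraph" where
  "delete_edge G e = G\<lparr>edges := edges G - {e}\<rparr>"

text \<open>
  The vertices of \<open>G / e\<close> are the classes of the identification: the set of the two ends of \<open>e\<close>
  is the new vertex, and every other vertex \<open>w\<close> becomes \<open>{w}\<close>. Edges parallel to \<open>e\<close> become loops.
\<close>

definition contract_vertex :: "('v, 'e) pre_multigraph \<Rightarrow> 'e \<Rightarrow> 'v \<Rightarrow> 'v set" where
  "contract_vertex G e w = (if w \<in> set_uprod (ends G e) then set_uprod (ends G e) else {w})"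

definition contract_edge :: "('v, 'e) pre_multigraph \<Rightarrow> 'e \<Rightarrow> ('v set, 'e) pre_multigraph" where
  "contract_edge G e =
     \<lparr> verts = contract_vertex G e ` verts G,
       edges = edges G - {e},
       ends = (\<lambda>f. map_uprod (contract_vertex G e) (ends G f)) \<rparr>"

text \<open>
  On the vertices of \<open>G / e\<close> this is \<open>\<upsilon> / e\<close>: the sum of the two weights on the new vertex,
  and \<open>\<upsilon> w\<close> on \<open>{w}\<close>.
\<close>

definition contract_weight :: "('v \<Rightarrow> real) \<Rightarrow> 'v set \<Rightarrow> real" where
  "contract_weight \<upsilon> B = (\<Sum>w\<in>B. \<upsilon> w)"


section \<open>Laplacians\<close>

definition edge_weight ::
    "('v, 'e) pre_multigraph \<Rightarrow> ('e \<Rightarrow> real) \<Rightarrow> 'v \<Rightarrow> 'v \<Rightarrow> real" where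
  "edge_weight G \<epsilon> u v =
     (if u = v then 2 else 1) * (\<Sum>f \<in> {f \<in> edges G. ends G f = Upair u v}. \<epsilon> f)"

definition degree_weight :: "('v, 'e) pre_multigraph \<Rightarrow> ('e \<Rightarrow> real) \<Rightarrow> 'v \<Rightarrow> real" where
  "degree_weight G \<epsilon> u = (\<Sum>v \<in> verts G. edge_weight G \<epsilon> u v)"

text \<open>A \<open>V \<times> V\<close> matrix is represented by its entry function; only entries indexed by \<open>V\<close> matter.\<close>

definition laplacian ::
    "('v, 'e) pre_multigraph \<Rightarrow> ('e \<Rightarrow> real) \<Rightarrow> 'v \<Rightarrow> 'v \<Rightarrow> real" where
  "laplacian G \<epsilon> u v = (if u = v then degree_weight G \<epsilon> u else 0) - edge_weight G \<epsilon> u v"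

text \<open>Left multiplication by the inverse of the diagonal matrix of \<open>\<upsilon>\<close> divides row \<open>u\<close> by \<open>\<upsilon> u\<close>.\<close>

definition weighted_laplacian ::
    "('v, 'e) pre_multigraph \<Rightarrow> ('v \<Rightarrow> real) \<Rightarrow> ('e \<Rightarrow> real) \<Rightarrow> 'v \<Rightarrow> 'v \<Rightarrow> real" where
  "weighted_laplacian G \<upsilon> \<epsilon> u v = inverse (\<upsilon> u) * laplacian G \<epsilon> u v"


section \<open>Eigenvalues of a matrix indexed by a finite set\<close>

definition matrix_of :: "'v list \<Rightarrow> ('v \<Rightarrow> 'v \<Rightarrow> 'a) \<Rightarrow> 'a mat" where
  "matrix_of vs M = mat (length vs) (length vs) (\<lambda>(i, j). M (vs ! i) (vs ! j))"

text \<open>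
  The characteristic polynomial is computed from an arbitrary enumeration of the index set;
  by \<open>char_poly_on_eq\<close> below, the choice is irrelevant.
\<close>

definition char_poly_on :: "'v set \<Rightarrow> ('v \<Rightarrow> 'v \<Rightarrow> 'a :: comm_ring_1) \<Rightarrow> 'a poly" where
  "char_poly_on V M = char_poly (matrix_of (SOME vs. distinct vs \<and> set vs = V) M)"

text \<open>
  The real eigenvalues in increasing order, each repeated according to its algebraic multiplicity;
  entry \<open>i\<close> of the list is the eigenvalue with one-based index \<open>i + 1\<close>.
\<close>

definition eigenvalues_on :: "'v set \<Rightarrow> ('v \<Rightarrow> 'v \<Rightarrow> real) \<Rightarrow> real list" where
  "eigenvalues_on V M = sorted_list_of_multiset (proots (char_poly_on V M))"

definition laplacian_eigenvalues ::
    "('v, 'e) pre_multigraph \<Rightarrow> ('v \<Rightarrow> real) \<Rightarrow> ('e \<Rightarrow> real) \<Rightarrow> real list" where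
  "laplacian_eigenvalues G \<upsilon> \<epsilon> = eigenvalues_on (verts G) (weighted_laplacian G \<upsilon> \<epsilon>)"

lemma char_poly_matrix_of_cong:
  fixes M :: "'v \<Rightarrow> 'v \<Rightarrow> 'a :: comm_ring_1"
  assumes vs: "distinct vs" and ws: "distinct ws" and eq: "set vs = set ws"
  shows "char_poly (matrix_of vs M) = char_poly (matrix_of ws M)"
proof (rule char_poly_similar)
  define n where "n = length vs"
  have len: "length ws = n" "length vs = n"
    by (simp_all add: n_def distinct_card[OF vs, symmetric] distinct_card[OF ws, symmetric] eq)
  define R :: "'v list \<Rightarrow> 'v list \<Rightarrow> 'a mat"
    where "R = (\<lambda>xs ys. mat n n (\<lambda>(i, j). if xs ! i = ys ! j then 1 else 0))"
  have mult: "mat n n (\<lambda>(i, j). if xs ! i = ys ! j then 1 else 0) * mat n n (\<lambda>(i, j). h (ys ! i) j)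
      = mat n n (\<lambda>(i, j). h (xs ! i) j)"
    if xy: "distinct ys" "set xs = set ys" "length xs = n" "length ys = n" for xs ys and h :: "'v \<Rightarrow> nat \<Rightarrow> 'a"
  proof (rule eq_matI; clarsimp simp: scalar_prod_def)
    fix i j assume ij: "i < n" "j < n"
    have "xs ! i \<in> set ys" unfolding xy(2)[symmetric] using ij xy(3) by (intro nth_mem) simp
    then obtain k where k: "k < n" "ys ! k = xs ! i"
      unfolding in_set_conv_nth xy(4) by blast
    have uniq: "xs ! i = ys ! l \<longleftrightarrow> l = k" if "l < n" for l
      using nth_eq_iff_index_eq[OF xy(1), of k l] that k(1) xy(4) unfolding k(2) by auto
    have "(\<Sum>l = 0..<n. (if xs ! i = ys ! l then 1 else 0) * h (ys ! l) j)
        = (\<Sum>l = 0..<n. if l = k then h (xs ! i) j else 0)"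
      by (intro sum.cong refl) (simp_all add: uniq k(2))
    also have "\<dots> = h (xs ! i) j" using k by simp
    finally show "(\<Sum>l = 0..<n. (if xs ! i = ys ! l then 1 else 0) * h (ys ! l) j) = h (xs ! i) j" .
  qed
  have mult': "mat n n (\<lambda>(i, j). h i (ys ! j)) * mat n n (\<lambda>(i, j). if ys ! i = xs ! j then 1 else 0)
      = mat n n (\<lambda>(i, j). h i (xs ! j))"
    if xy: "distinct ys" "set xs = set ys" "length xs = n" "length ys = n" for xs ys and h :: "nat \<Rightarrow> 'v \<Rightarrow> 'a"
  proof (rule eq_matI; clarsimp simp: scalar_prod_def)
    fix i j assume ij: "i < n" "j < n"
    have "xs ! j \<in> set ys" unfolding xy(2)[symmetric] using ij xy(3) by (intro nth_mem) simp
    then obtain k where k: "k < n" "ys ! k = xs ! j"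
      unfolding in_set_conv_nth xy(4) by blast
    have uniq: "ys ! l = xs ! j \<longleftrightarrow> l = k" if "l < n" for l
      using nth_eq_iff_index_eq[OF xy(1), of l k] that k xy(4) by simp
    have "(\<Sum>l = 0..<n. h i (ys ! l) * (if ys ! l = xs ! j then 1 else 0))
        = (\<Sum>l = 0..<n. if l = k then h i (xs ! j) else 0)"
      by (intro sum.cong refl) (simp_all add: uniq k(2))
    also have "\<dots> = h i (xs ! j)" using k by simp
    finally show "(\<Sum>l = 0..<n. h i (ys ! l) * (if ys ! l = xs ! j then 1 else 0)) = h i (xs ! j)" .
  qed
  have one: "mat n n (\<lambda>(i, j). if xs ! i = xs ! j then 1 else 0) = (1\<^sub>m n :: 'a mat)"
    if "distinct xs" "length xs = n" for xs :: "'v list"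
    using that by (intro eq_matI) (auto simp: nth_eq_iff_index_eq)
  show "similar_mat (matrix_of vs M) (matrix_of ws M)"
  proof (rule similar_matI[where n = n and P = "R vs ws" and Q = "R ws vs"])
    show "{matrix_of vs M, matrix_of ws M, R vs ws, R ws vs} \<subseteq> carrier_mat n n"
      using len by (auto simp: matrix_of_def R_def)
    show "R vs ws * R ws vs = 1\<^sub>m n"
      unfolding R_def
      by (rule trans[OF mult[OF ws eq len(2) len(1), where h = "\<lambda>x j. if x = vs ! j then 1 else 0"]
            one[OF vs len(2)]])
    show "R ws vs * R vs ws = 1\<^sub>m n"
      unfolding R_def
      by (rule trans[OF mult[OF vs eq[symmetric] len(1) len(2), where h = "\<lambda>x j. if x = ws ! j then 1 else 0"]
            one[OF ws len(1)]])
    show "matrix_of vs M = R vs ws * matrix_of ws M * R ws vs"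
      unfolding R_def matrix_of_def len
        mult[OF ws eq len(2) len(1), where h = "\<lambda>x j. M x (ws ! j)"]
      by (rule mult'[OF ws eq len(2) len(1), where h = "\<lambda>i y. M (vs ! i) y", symmetric])
  qed
qed

lemma char_poly_on_eq:
  assumes "distinct vs" "set vs = V"
  shows "char_poly_on V M = char_poly (matrix_of vs M)"
proof -
  have "distinct (SOME vs. distinct vs \<and> set vs = V) \<and> set (SOME vs. distinct vs \<and> set vs = V) = V"
    using assms by (intro someI[of "\<lambda>vs. distinct vs \<and> set vs = V"]) auto
  then show ?thesis
    unfolding char_poly_on_def using assms by (intro char_poly_matrix_of_cong) auto
qed

end

theory Submission
  imports Defs
begin

text \<open>
  All three spectra belong to nearly the same quadratic form. For a function \<open>g\<close> on the vertices, the
  Laplacian form is the sum of \<open>\<epsilon> f * (g x - g y)\<^sup>2\<close> over the edges \<open>f\<close> with ends \<open>x\<close> and \<open>y\<close>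
  (lemma \<open>quadratic_form_laplacian\<close>), and the weighted Laplacian eigenvalues are those of this form
  relative to the inner product weighted by \<open>\<upsilon>\<close>. Let \<open>a\<close> and \<open>b\<close> be the ends of \<open>e\<close>.

  Deleting \<open>e\<close> removes the nonnegative term \<open>\<epsilon> e * (g a - g b)\<^sup>2\<close>, so every eigenvalue can only go down:
  \<open>\<mu>\<^sub>i \<le> \<lambda>\<^sub>i\<close>. Functions on \<open>G / e\<close> are, by pullback along the contraction, exactly the functions on \<open>G\<close> with
  \<open>g a = g b\<close>. Since the weights of the merged vertices add up, this identification is isometric, and on
  the hyperplane \<open>g a = g b\<close> the forms of \<open>G\<close>, \<open>G - e\<close> and \<open>G / e\<close> coincide. Restricting a form to a subspace
  never lowers its eigenvalues, whence \<open>\<lambda>\<^sub>i \<le> \<nu>\<^sub>i\<close>; restricting it to a hyperplane raises each at most to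
  the next one, whence \<open>\<nu>\<^sub>i \<le> \<mu>\<^sub>i\<^sub>+\<^sub>1\<close>.

  The three inequalities are instances of one comparison principle, \<open>eigenvalue_comparison\<close>: given a
  linear map between function spaces that, on the subspace cut out by \<open>k\<close> linear constraints,
  preserves the norm and does not increase the form, the \<open>i\<close>-th eigenvalue of the
  target is at most the eigenvalue of index \<open>i + k\<close> of the source. It follows by counting dimensions
  in orthonormal eigenbases. Their existence (\<open>eigenbasis_weighted\<close>) is the spectral theorem for
  real symmetric matrices, proved for an arbitrary order of the roots of the
  characteristic polynomial (\<open>orthogonal_diagonalisation\<close>), so that the basis can be
  aligned with the sorted list of eigenvalues counted with algebraic multiplicity.
\<close>

section \<open>Orthogonal diagonalisation of real symmetric matrices\<close>

lemma transpose_orthogonal_commute: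
  fixes P :: "'a :: field mat"
  assumes "P \<in> carrier_mat n n" and "P\<^sup>T * P = 1\<^sub>m n"
  shows "P * P\<^sup>T = 1\<^sub>m n"
  using assms mat_mult_left_right_inverse[of "P\<^sup>T" n P] by auto

lemma char_poly_orthogonal_conj:
  fixes A P :: "'a :: field mat"
  assumes A: "A \<in> carrier_mat n n" and P: "P \<in> carrier_mat n n" and PP: "P\<^sup>T * P = 1\<^sub>m n"
  shows "char_poly (P\<^sup>T * A * P) = char_poly A"
proof (rule char_poly_similar, rule similar_matI[where n = n and P = "P\<^sup>T" and Q = P])
  show "P * P\<^sup>T = 1\<^sub>m n" by (rule transpose_orthogonal_commute[OF P PP])
qed (use A P PP in auto)

lemma symmetric_conj:
  fixes A P :: "'a :: comm_semiring_0 mat"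
  assumes A: "A \<in> carrier_mat n n" and P: "P \<in> carrier_mat n n" and sym: "A\<^sup>T = A"
  shows "(P\<^sup>T * A * P)\<^sup>T = P\<^sup>T * A * P"
proof -
  have "(P\<^sup>T * A * P)\<^sup>T = P\<^sup>T * (P\<^sup>T * A)\<^sup>T"
    using A P by (subst transpose_mult[of _ n n _ n]) auto
  also have "(P\<^sup>T * A)\<^sup>T = A * P"
    using A P by (subst transpose_mult[of _ n n _ n]) (auto simp: sym)
  also have "P\<^sup>T * (A * P) = P\<^sup>T * A * P"
    using A P by (subst assoc_mult_mat[of _ n n _ n _ n]) auto
  finally show ?thesis .
qed

text \<open>
  The witness is the Householder reflection that exchanges \<open>v\<close> with the first unit vector: it
  reflects in the hyperplane orthogonal to their difference \<open>u\<close>. Being an explicit symmetric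
  involution, it gives an orthonormal basis starting with \<open>v\<close> without any orthogonalisation process.
\<close>

lemma ex_orthogonal_mat_first_col:
  fixes v :: "real vec"
  assumes v: "v \<in> carrier_vec n" and unit: "v \<bullet> v = 1" and n: "n > 0"
  shows "\<exists>W \<in> carrier_mat n n. W\<^sup>T * W = 1\<^sub>m n \<and> col W 0 = v"
proof -
  define u where "u i = (if i = 0 then 1 else 0) - v $ i" for i
  define s where "s = (\<Sum>k<n. u k * u k)"
  define c where "c = 2 / s"
  define W where "W = mat n n (\<lambda>(i, j). (if i = j then 1 else 0) - c * u i * u j)"
  have vv: "(\<Sum>k<n. v $ k * v $ k) = 1"
    using unit v by (simp add: scalar_prod_def lessThan_atLeast0)
  have "s = (\<Sum>k<n. (if k = 0 then 1 - 2 * v $ 0 else 0) + v $ k * v $ k)"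
    unfolding s_def u_def by (intro sum.cong) (auto simp: algebra_simps)
  also have "\<dots> = 2 - 2 * v $ 0" using n by (simp add: sum.distrib vv)
  finally have s: "s = 2 * u 0" by (simp add: u_def)
  \<comment> \<open>For \<open>v\<close> the first unit vector, \<open>s = 0\<close> and \<open>2 / 0 = 0\<close> makes \<open>W\<close> the identity.\<close>
  have cu: "c * u 0 * u i = u i" if "i < n" for i
  proof (cases "s = 0")
    case True
    then have "\<forall>k\<in>{..<n}. u k * u k = 0"
      unfolding s_def by (subst (asm) sum_nonneg_eq_0_iff) auto
    then show ?thesis using that by auto
  next
    case False
    then show ?thesis using s by (simp add: c_def)
  qed
  have cs: "c * c * s = 2 * c" by (simp add: c_def)
  have "W\<^sup>T * W = 1\<^sub>m n"
  proof (rule eq_matI)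
    fix i j assume "i < dim_row (1\<^sub>m n :: real mat)" "j < dim_col (1\<^sub>m n :: real mat)"
    then have ij: "i < n" "j < n" by auto
    have "(W\<^sup>T * W) $$ (i, j) = (\<Sum>k<n. ((if k = i then 1 else 0) - c * u k * u i)
        * ((if k = j then 1 else 0) - c * u k * u j))"
      using ij by (simp add: W_def scalar_prod_def lessThan_atLeast0)
    also have "\<dots> = (\<Sum>k<n. (if k = i then (if i = j then 1 else 0) - c * u i * u j else 0)
        + (if k = j then - (c * u i * u j) else 0) + c * c * u i * u j * (u k * u k))"
      by (intro sum.cong) (auto simp: algebra_simps)
    also have "\<dots> = (if i = j then 1 else 0) - 2 * c * u i * u j + (c * c * s) * u i * u j"
      using ij by (simp add: sum.distrib s_def sum_distrib_left[symmetric] del: sum_distrib_left)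
    also have "\<dots> = (if i = j then 1 else 0)" unfolding cs by simp
    finally show "(W\<^sup>T * W) $$ (i, j) = 1\<^sub>m n $$ (i, j)" using ij by simp
  qed (auto simp: W_def)
  moreover have "col W 0 = v"
  proof (rule eq_vecI)
    fix i assume "i < dim_vec v"
    then have i: "i < n" using v by auto
    have "col W 0 $ i = (if i = 0 then 1 else 0) - c * u 0 * u i"
      using i n by (simp add: W_def mult.commute mult.left_commute)
    then show "col W 0 $ i = v $ i" unfolding cu[OF i] by (simp add: u_def)
  qed (use v in \<open>auto simp: W_def\<close>)
  ultimately show ?thesis by (intro bexI[of _ W]) (auto simp: W_def)
qed

lemma ex_unit_eigenvector:
  fixes A :: "real mat"
  assumes A: "A \<in> carrier_mat n n" and e: "eigenvalue A e"
  shows "\<exists>v \<in> carrier_vec n. v \<bullet> v = 1 \<and> A *\<^sub>v v = e \<cdot>\<^sub>v v"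
proof -
  from e obtain x where x: "x \<in> carrier_vec n" "x \<noteq> 0\<^sub>v n" "A *\<^sub>v x = e \<cdot>\<^sub>v x"
    using A unfolding eigenvalue_def eigenvector_def by auto
  define r where "r = sqrt (x \<bullet> x)"
  have "x \<bullet> x \<ge> 0" unfolding scalar_prod_def by (intro sum_nonneg) auto
  moreover have "x \<bullet> x \<noteq> 0"
  proof
    assume "x \<bullet> x = 0"
    then have "\<forall>i\<in>{0..<n}. x $ i * x $ i = 0"
      unfolding scalar_prod_def using x(1) by (subst (asm) sum_nonneg_eq_0_iff) auto
    then have "x = 0\<^sub>v n" using x(1) by (intro eq_vecI) auto
    with x(2) show False by simp
  qed
  ultimately have r: "r * r = x \<bullet> x" "r \<noteq> 0" unfolding r_def by auto
  have "((1 / r) \<cdot>\<^sub>v x) \<bullet> ((1 / r) \<cdot>\<^sub>v x) = 1"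
    using x(1) r by (simp add: smult_scalar_prod_distrib[of _ n] scalar_prod_smult_distrib[of _ n]
        r(1)[symmetric])
  moreover have "A *\<^sub>v ((1 / r) \<cdot>\<^sub>v x) = e \<cdot>\<^sub>v ((1 / r) \<cdot>\<^sub>v x)"
    using x A by (simp add: mult_mat_vec smult_smult_assoc mult.commute)
  ultimately show ?thesis using x(1) by (intro bexI[of _ "(1 / r) \<cdot>\<^sub>v x"]) auto
qed

text \<open>
  The spectral theorem, by deflation. Conjugating \<open>A\<close> with an orthogonal \<open>W\<close> whose first column is a
  unit eigenvector for the first listed root \<open>e\<close> clears the first column except for \<open>e\<close>; symmetry
  clears the first row as well. The remaining block is symmetric, its characteristic
  polynomial has the remaining roots, and the induction hypothesis diagonalises it. Since the
  roots are split off in the order of the list, the list may be prescribed in any order,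
  in particular sorted.
\<close>

lemma orthogonal_diagonalisation:
  fixes A :: "real mat"
  assumes "A \<in> carrier_mat n n" and "A\<^sup>T = A"
    and "char_poly A = (\<Prod>e\<leftarrow>es. [:- e, 1:])"
  shows "\<exists>P \<in> carrier_mat n n. P\<^sup>T * P = 1\<^sub>m n \<and>
    P\<^sup>T * A * P = mat n n (\<lambda>(i, j). if i = j then es ! i else 0)"
  using assms
proof (induction n arbitrary: A es)
  case 0
  show ?case by (intro bexI[of _ "1\<^sub>m 0"]) (use 0 in auto)
next
  case (Suc n A es0)
  note A = Suc.prems(1) and sym = Suc.prems(2) and cp = Suc.prems(3)
  have "length es0 = Suc n"
    using degree_linear_factors[of uminus es0, folded cp] degree_monic_char_poly[OF A] by simp
  then obtain e es where es0: "es0 = e # es" by (cases es0) auto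
  have "eigenvalue A e" unfolding eigenvalue_root_char_poly[OF A] cp es0 by simp
  from ex_unit_eigenvector[OF A this] obtain v where v: "v \<in> carrier_vec (Suc n)" "v \<bullet> v = 1"
    and Av: "A *\<^sub>v v = e \<cdot>\<^sub>v v" by auto
  from ex_orthogonal_mat_first_col[OF v] obtain W where W: "W \<in> carrier_mat (Suc n) (Suc n)"
    and WW: "W\<^sup>T * W = 1\<^sub>m (Suc n)" and Wv: "col W 0 = v" by auto
  define B where "B = W\<^sup>T * A * W"
  have B: "B \<in> carrier_mat (Suc n) (Suc n)" using A W unfolding B_def by auto
  have symB: "B\<^sup>T = B" unfolding B_def by (rule symmetric_conj[OF A W sym])
  define E where "E = mat 1 1 (\<lambda>_. e)"
  define C where "C = mat n n (\<lambda>(i, j). B $$ (Suc i, Suc j))"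
  have E: "E \<in> carrier_mat 1 1" and C: "C \<in> carrier_mat n n" by (auto simp: E_def C_def)
  have WTv: "W\<^sup>T *\<^sub>v v = unit_vec (Suc n) 0"
  proof -
    have "W\<^sup>T *\<^sub>v v = col (W\<^sup>T * W) 0" unfolding Wv[symmetric] using W by (intro eq_vecI) auto
    then show ?thesis unfolding WW by simp
  qed
  have "col B 0 = W\<^sup>T *\<^sub>v (A *\<^sub>v v)"
  proof -
    have "col B 0 = (W\<^sup>T * A) *\<^sub>v v" unfolding B_def Wv[symmetric] using A W by (intro col_mult2[of _ _ "Suc n"]) auto
    then show ?thesis using A W v(1) by simp
  qed
  also have "\<dots> = e \<cdot>\<^sub>v unit_vec (Suc n) 0" unfolding Av using W v(1) WTv
    by (simp add: mult_mat_vec[of _ "Suc n" "Suc n"])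
  finally have colB: "col B 0 = e \<cdot>\<^sub>v unit_vec (Suc n) 0" .
  have Bi0: "B $$ (i, 0) = (if i = 0 then e else 0)" if "i < Suc n" for i
    using arg_cong[OF colB, of "\<lambda>w. w $ i"] that B by auto
  have B0i: "B $$ (0, i) = (if i = 0 then e else 0)" if "i < Suc n" for i
    using Bi0[OF that] arg_cong[OF symB, of "\<lambda>M. M $$ (i, 0)"] that B by auto
  have block: "B = four_block_mat E (0\<^sub>m 1 n) (0\<^sub>m n 1) C"
    by (rule eq_matI) (use B Bi0 B0i in \<open>auto simp: E_def C_def\<close>)
  have "char_poly B = char_poly E * char_poly C"
    unfolding block by (rule char_poly_four_block_zeros_col[OF E _ C]) auto
  moreover have "char_poly E = [:- e, 1:]"
    by (simp add: E_def char_poly_defs det_def sign_def)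
  moreover have "char_poly B = [:- e, 1:] * (\<Prod>e\<leftarrow>es. [:- e, 1:])"
    unfolding B_def char_poly_orthogonal_conj[OF A W WW] cp es0 by simp
  ultimately have cpC: "char_poly C = (\<Prod>e\<leftarrow>es. [:- e, 1:])"
    by (metis mult_cancel_left pCons_eq_0_iff zero_neq_one)
  have symC: "C\<^sup>T = C"
  proof (rule eq_matI)
    fix i j assume "i < dim_row C" "j < dim_col C"
    then show "C\<^sup>T $$ (i, j) = C $$ (i, j)"
      using arg_cong[OF symB, of "\<lambda>M. M $$ (Suc i, Suc j)"] B by (simp add: C_def)
  qed (use C in auto)
  from Suc.IH[OF C symC cpC] obtain P where P: "P \<in> carrier_mat n n" and PP: "P\<^sup>T * P = 1\<^sub>m n"
    and PCP: "P\<^sup>T * C * P = mat n n (\<lambda>(i, j). if i = j then es ! i else 0)" by auto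
  define F where "F = four_block_mat (1\<^sub>m 1) (0\<^sub>m 1 n) (0\<^sub>m n 1) P"
  have F: "F \<in> carrier_mat (Suc n) (Suc n)"
    using P unfolding F_def by (metis four_block_carrier_mat one_carrier_mat plus_1_eq_Suc)
  have FT: "F\<^sup>T = four_block_mat (1\<^sub>m 1) (0\<^sub>m 1 n) (0\<^sub>m n 1) (P\<^sup>T)"
    unfolding F_def using P by (subst transpose_four_block_mat[of _ 1 1 _ n _ n]) auto
  have FF: "F\<^sup>T * F = 1\<^sub>m (Suc n)"
    unfolding FT unfolding F_def using P PP
    by (subst mult_four_block_mat[of _ 1 1 _ n _ n _ _ 1 _ n]) auto
  have FBF: "F\<^sup>T * B * F = four_block_mat E (0\<^sub>m 1 n) (0\<^sub>m n 1) (P\<^sup>T * C * P)"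
  proof -
    have "F\<^sup>T * B = four_block_mat E (0\<^sub>m 1 n) (0\<^sub>m n 1) (P\<^sup>T * C)"
      unfolding FT block using P E C
      by (subst mult_four_block_mat[of _ 1 1 _ n _ n _ _ 1 _ n]) auto
    then show ?thesis
      unfolding F_def using P E C
      by (simp, subst mult_four_block_mat[of _ 1 1 _ n _ n _ _ 1 _ n]) auto
  qed
  define R where "R = W * F"
  have R: "R \<in> carrier_mat (Suc n) (Suc n)" using W F unfolding R_def by auto
  have RT: "R\<^sup>T = F\<^sup>T * W\<^sup>T" unfolding R_def by (rule transpose_mult[OF W F])
  have "R\<^sup>T * R = F\<^sup>T * (W\<^sup>T * W) * F"
    unfolding RT unfolding R_def using W F by (simp add: assoc_mult_mat[of _ "Suc n" "Suc n" _ "Suc n" _ "Suc n"])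
  also have "\<dots> = 1\<^sub>m (Suc n)" unfolding WW using F FF by simp
  finally have RR: "R\<^sup>T * R = 1\<^sub>m (Suc n)" .
  have "R\<^sup>T * A * R = F\<^sup>T * B * F"
    unfolding RT B_def unfolding R_def using W F A by (simp add: assoc_mult_mat[of _ "Suc n" "Suc n" _ "Suc n" _ "Suc n"])
  also have "\<dots> = mat (Suc n) (Suc n) (\<lambda>(i, j). if i = j then es0 ! i else 0)"
    unfolding FBF PCP es0 by (rule eq_matI) (auto simp: E_def nth_Cons')
  finally show ?case using R RR by auto
qed

text \<open>
  Over the complex numbers the characteristic polynomial splits. If \<open>A x = a x\<close>, then \<open>x\<^sup>* A x\<close> equals
  its own conjugate because \<open>A\<close> is real and symmetric, and it equals \<open>a\<close> times the positive number
  \<open>x\<^sup>* x\<close>; so all roots are real and the factorisation descends to the reals.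
\<close>

lemma char_poly_symmetric_splits:
  fixes A :: "real mat"
  assumes A: "A \<in> carrier_mat n n" and sym: "A\<^sup>T = A"
  shows "\<exists>es. char_poly A = (\<Prod>e\<leftarrow>es. [:- e, 1:])"
proof -
  let ?A = "map_mat complex_of_real A"
  have cA: "?A \<in> carrier_mat n n" using A by auto
  obtain as where as: "char_poly ?A = (\<Prod>a\<leftarrow>as. [:- a, 1:])"
    using char_poly_factorized[OF cA] by auto
  have real: "a \<in> \<real>" if "a \<in> set as" for a
  proof -
    have "eigenvalue ?A a" unfolding eigenvalue_root_char_poly[OF cA] as poly_prod_list
      using that by (auto simp: prod_list_zero_iff)
    then obtain x where x: "x \<in> carrier_vec n" "x \<noteq> 0\<^sub>v n" "?A *\<^sub>v x = a \<cdot>\<^sub>v x"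
      using cA unfolding eigenvalue_def eigenvector_def by auto
    have ev: "(\<Sum>j<n. of_real (A $$ (i, j)) * x $ j) = a * x $ i" if "i < n" for i
      using arg_cong[OF x(3), of "\<lambda>w. w $ i"] that A x(1)
      by (simp add: scalar_prod_def lessThan_atLeast0)
    define q where "q = (\<Sum>i<n. \<Sum>j<n. cnj (x $ i) * (of_real (A $$ (i, j)) * x $ j))"
    define N where "N = (\<Sum>i<n. (cmod (x $ i))\<^sup>2)"
    have symij: "A $$ (i, j) = A $$ (j, i)" if "i < n" "j < n" for i j
      using arg_cong[OF sym, of "\<lambda>M. M $$ (i, j)"] that A by auto
    have "cnj q = (\<Sum>i<n. \<Sum>j<n. cnj (x $ j) * (of_real (A $$ (j, i)) * x $ i))"
      unfolding q_def by (auto simp: symij intro!: sum.cong)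
    also have "\<dots> = q" unfolding q_def by (rule sum.swap)
    finally have "q \<in> \<real>" by (simp add: Reals_cnj_iff)
    moreover have "q = a * of_real N"
    proof -
      have "q = (\<Sum>i<n. cnj (x $ i) * (a * x $ i))"
        unfolding q_def by (simp add: sum_distrib_left[symmetric] ev)
      also have "\<dots> = a * of_real N"
        by (simp only: N_def of_real_sum sum_distrib_left complex_norm_square mult_ac)
      finally show ?thesis .
    qed
    moreover have "N \<noteq> 0"
    proof
      assume "N = 0"
      then have "\<forall>i\<in>{..<n}. (cmod (x $ i))\<^sup>2 = 0"
        unfolding N_def by (subst (asm) sum_nonneg_eq_0_iff) auto
      then have "x = 0\<^sub>v n" using x(1) by (intro eq_vecI) auto
      with x(2) show False by simp
    qed
    ultimately have "a = q / of_real N" "q \<in> \<real>" by auto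
    then show ?thesis by (metis Reals_divide Reals_of_real)
  qed
  interpret hom: map_poly_inj_idom_hom complex_of_real ..
  have lin: "map_poly complex_of_real (\<Prod>e\<leftarrow>xs. [:- e, 1:]) = (\<Prod>e\<leftarrow>xs. [:- complex_of_real e, 1:])"
    for xs
    by (induction xs) (simp_all add: hom_distribs)
  have "as = map complex_of_real (map Re as)"
    using real by (auto simp: map_idI)
  then have "char_poly ?A = (\<Prod>a\<leftarrow>map complex_of_real (map Re as). [:- a, 1:])"
    unfolding as by (rule arg_cong)
  then have "char_poly ?A = map_poly complex_of_real (\<Prod>e\<leftarrow>map Re as. [:- e, 1:])"
    unfolding lin by (simp only: map_map o_def)
  moreover have "map_poly complex_of_real (char_poly A) = char_poly ?A"
    by (rule of_real_hom.char_poly_hom[OF A, symmetric])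
  ultimately have eq: "map_poly complex_of_real (char_poly A)
      = map_poly complex_of_real (\<Prod>e\<leftarrow>map Re as. [:- e, 1:])" by (simp only:)
  have "char_poly A = (\<Prod>e\<leftarrow>map Re as. [:- e, 1:])"
  proof (rule poly_eqI)
    fix k
    show "coeff (char_poly A) k = coeff (\<Prod>e\<leftarrow>map Re as. [:- e, 1:]) k"
      using arg_cong[OF eq, of "\<lambda>q. coeff q k"] by (simp add: coeff_map_poly)
  qed
  then show ?thesis by (rule exI)
qed

section \<open>Eigenbases for a weighted inner product\<close>

definition weighted_inner :: "'v set \<Rightarrow> ('v \<Rightarrow> real) \<Rightarrow> ('v \<Rightarrow> real) \<Rightarrow> ('v \<Rightarrow> real) \<Rightarrow> real" where
  "weighted_inner V \<upsilon> f g = (\<Sum>v\<in>V. \<upsilon> v * f v * g v)"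

definition quadratic_form :: "'v set \<Rightarrow> ('v \<Rightarrow> 'v \<Rightarrow> real) \<Rightarrow> ('v \<Rightarrow> real) \<Rightarrow> real" where
  "quadratic_form V L f = (\<Sum>u\<in>V. \<Sum>v\<in>V. f u * L u v * f v)"

text \<open>
  Besides orthonormality, completeness of the basis is recorded only through its consequences for
  the two quadratic forms, Parseval's identity and the diagonal expression of \<open>L\<close>: a comparison
  of spectra reads off Rayleigh quotients from these and needs no expansion of functions.
\<close>

definition eigenbasis ::
    "'v set \<Rightarrow> ('v \<Rightarrow> real) \<Rightarrow> ('v \<Rightarrow> 'v \<Rightarrow> real) \<Rightarrow> real list \<Rightarrow> (nat \<Rightarrow> 'v \<Rightarrow> real) \<Rightarrow> bool" where
  "eigenbasis V \<upsilon> L es b \<longleftrightarrow>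
     (\<forall>i<card V. \<forall>j<card V. weighted_inner V \<upsilon> (b i) (b j) = (if i = j then 1 else 0)) \<and>
     (\<forall>g. weighted_inner V \<upsilon> g g = (\<Sum>i<card V. (weighted_inner V \<upsilon> g (b i))\<^sup>2)) \<and>
     (\<forall>g. quadratic_form V L g = (\<Sum>i<card V. es ! i * (weighted_inner V \<upsilon> g (b i))\<^sup>2))"

lemma sum_diagonalised_form:
  fixes T P :: "nat \<Rightarrow> nat \<Rightarrow> real"
  assumes "\<And>k l. k < n \<Longrightarrow> l < n \<Longrightarrow> T k l = (\<Sum>i<n. P k i * d i * P l i)"
  shows "(\<Sum>k<n. \<Sum>l<n. y k * T k l * y l) = (\<Sum>i<n. d i * (\<Sum>k<n. y k * P k i)\<^sup>2)"
proof -
  have square: "(\<Sum>k<n. y k * P k i)\<^sup>2 = (\<Sum>k<n. \<Sum>l<n. (y k * P k i) * (y l * P l i))" for i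
    by (simp only: power2_eq_square sum_product)
  have "(\<Sum>k<n. \<Sum>l<n. y k * T k l * y l) = (\<Sum>k<n. \<Sum>l<n. \<Sum>i<n. d i * ((y k * P k i) * (y l * P l i)))"
    by (intro sum.cong refl) (simp add: assms sum_distrib_left sum_distrib_right mult_ac)
  also have "\<dots> = (\<Sum>k<n. \<Sum>i<n. \<Sum>l<n. d i * ((y k * P k i) * (y l * P l i)))"
    by (intro sum.cong refl sum.swap)
  also have "\<dots> = (\<Sum>i<n. \<Sum>k<n. \<Sum>l<n. d i * ((y k * P k i) * (y l * P l i)))"
    by (rule sum.swap)
  also have "\<dots> = (\<Sum>i<n. d i * (\<Sum>k<n. y k * P k i)\<^sup>2)"
    by (simp only: square sum_distrib_left)
  finally show ?thesis .
qed

text \<open>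
  The spectral theorem in coordinates, with the roots in increasing order. Both orthogonality
  relations are needed: the columns of \<open>P\<close> will be the basis vectors, and orthogonality of the rows
  is Parseval's identity.
\<close>

lemma orthogonal_diagonalisation_sorted:
  fixes A :: "real mat"
  assumes A: "A \<in> carrier_mat n n" and sym: "A\<^sup>T = A"
  defines "es \<equiv> sorted_list_of_multiset (proots (char_poly A))"
  shows "length es = n"
    and "\<exists>P. (\<forall>i<n. \<forall>j<n. (\<Sum>k<n. P k i * P k j) = (if i = j then 1 else 0)) \<and>
      (\<forall>k<n. \<forall>l<n. (\<Sum>i<n. P k i * P l i) = (if k = l then 1 else 0)) \<and>
      (\<forall>k<n. \<forall>l<n. A $$ (k, l) = (\<Sum>i<n. P k i * es ! i * P l i))"
proof -
  obtain xs where xs: "char_poly A = (\<Prod>e\<leftarrow>xs. [:- e, 1:])"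
    using char_poly_symmetric_splits[OF A sym] by blast
  have "mset es = mset xs"
  proof -
    have "proots (\<Prod>e\<leftarrow>xs. [:- e, 1:]) = mset xs"
    proof (induction xs)
      case (Cons x xs)
      have "(\<Prod>e\<leftarrow>xs. [:- e, 1:]) \<noteq> 0" by (auto simp: prod_list_zero_iff)
      then have "proots ([:- x, 1:] * (\<Prod>e\<leftarrow>xs. [:- e, 1:])) = {#x#} + mset xs"
        by (subst proots_mult) (simp_all add: Cons.IH)
      then show ?case by simp
    qed simp
    then show ?thesis by (simp add: es_def xs)
  qed
  then have cp: "char_poly A = (\<Prod>e\<leftarrow>es. [:- e, 1:])"
    unfolding xs by (metis mset_map prod_mset_prod_list)
  then show "length es = n"
    using degree_linear_factors[of uminus es, folded cp] degree_monic_char_poly[OF A] by simp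
  from orthogonal_diagonalisation[OF A sym cp] obtain P where P: "P \<in> carrier_mat n n"
    and PP: "P\<^sup>T * P = 1\<^sub>m n"
    and PAP: "P\<^sup>T * A * P = mat n n (\<lambda>(i, j). if i = j then es ! i else 0)" (is "_ = ?D") by auto
  have PP': "P * P\<^sup>T = 1\<^sub>m n" by (rule transpose_orthogonal_commute[OF P PP])
  have D: "?D \<in> carrier_mat n n" by auto
  have "P * ?D * P\<^sup>T = (P * P\<^sup>T) * A * (P * P\<^sup>T)"
    unfolding PAP[symmetric] using A P
    by (simp add: assoc_mult_mat[of _ n n _ n _ n])
  also have "\<dots> = A" unfolding PP' using A by simp
  finally have PDP: "A = P * ?D * P\<^sup>T" by simp
  have PD: "(P * ?D) $$ (k, i) = P $$ (k, i) * es ! i" if "k < n" "i < n" for k i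
    using that P by (simp add: scalar_prod_def if_distrib[of "\<lambda>x. _ * x"] cong: if_cong)
  have "A $$ (k, l) = (\<Sum>i<n. P $$ (k, i) * es ! i * P $$ (l, i))" if "k < n" "l < n" for k l
  proof -
    define X where "X = P * ?D"
    have X: "X \<in> carrier_mat n n" using P unfolding X_def by auto
    have "A $$ (k, l) = (X * P\<^sup>T) $$ (k, l)" using PDP unfolding X_def by simp
    also have "\<dots> = (\<Sum>i<n. X $$ (k, i) * P $$ (l, i))"
      using that P X by (simp add: scalar_prod_def lessThan_atLeast0)
    also have "\<dots> = (\<Sum>i<n. P $$ (k, i) * es ! i * P $$ (l, i))"
      unfolding X_def by (intro sum.cong refl) (simp add: PD that del: index_mult_mat)
    finally show ?thesis .
  qed
  moreover have "(\<Sum>k<n. P $$ (k, i) * P $$ (k, j)) = (if i = j then 1 else 0)" if "i < n" "j < n" for i j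
    using arg_cong[OF PP, of "\<lambda>M. M $$ (i, j)"] that P by (simp add: scalar_prod_def lessThan_atLeast0)
  moreover have "(\<Sum>i<n. P $$ (k, i) * P $$ (l, i)) = (if k = l then 1 else 0)" if "k < n" "l < n" for k l
    using arg_cong[OF PP', of "\<lambda>M. M $$ (k, l)"] that P by (simp add: scalar_prod_def lessThan_atLeast0)
  ultimately show "\<exists>P. (\<forall>i<n. \<forall>j<n. (\<Sum>k<n. P k i * P k j) = (if i = j then 1 else 0)) \<and>
      (\<forall>k<n. \<forall>l<n. (\<Sum>i<n. P k i * P l i) = (if k = l then 1 else 0)) \<and>
      (\<forall>k<n. \<forall>l<n. A $$ (k, l) = (\<Sum>i<n. P k i * es ! i * P l i))"
    by (intro exI[of _ "\<lambda>k i. P $$ (k, i)"]) blast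
qed

text \<open>
  With \<open>s = sqrt \<upsilon>\<close>, conjugation by the diagonal matrix of \<open>s\<close> turns \<open>L\<close>, with row \<open>u\<close> divided by \<open>\<upsilon> u\<close>, into
  the symmetric matrix with entries \<open>L u v / (s u * s v)\<close>. The two have the same characteristic polynomial, and dividing
  the orthonormal eigenvectors of the latter by \<open>s\<close> gives functions orthonormal for the weight \<open>\<upsilon>\<close>.
\<close>

lemma eigenbasis_weighted:
  fixes L :: "'v \<Rightarrow> 'v \<Rightarrow> real"
  assumes fin: "finite V" and pos: "\<And>v. v \<in> V \<Longrightarrow> \<upsilon> v > 0"
    and sym: "\<And>u v. u \<in> V \<Longrightarrow> v \<in> V \<Longrightarrow> L u v = L v u"
  defines "es \<equiv> eigenvalues_on V (\<lambda>u v. inverse (\<upsilon> u) * L u v)"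
  shows "length es = card V"
    and "\<exists>b. eigenbasis V \<upsilon> L es b"
proof -
  obtain vs where vs: "set vs = V" "distinct vs" using finite_distinct_list[OF fin] by auto
  define n where "n = card V"
  have len: "length vs = n" using vs distinct_card n_def by fastforce
  define s where "s k = sqrt (\<upsilon> (vs ! k))" for k
  have s: "s k > 0" "s k * s k = \<upsilon> (vs ! k)" if "k < n" for k
    using pos[of "vs ! k"] that len vs(1) nth_mem[of k vs] unfolding s_def by auto
  define M where "M = matrix_of vs (\<lambda>u v. inverse (\<upsilon> u) * L u v)"
  define A where "A = mat n n (\<lambda>(i, j). L (vs ! i) (vs ! j) / (s i * s j))"
  define D where "D = mat n n (\<lambda>(i, j). if i = j then s i else 0)"
  define D' where "D' = mat n n (\<lambda>(i, j). if i = j then 1 / s i else 0)"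
  have carr: "M \<in> carrier_mat n n" "A \<in> carrier_mat n n" "D \<in> carrier_mat n n" "D' \<in> carrier_mat n n"
    by (auto simp: M_def A_def D_def D'_def matrix_of_def len)
  have "similar_mat A M"
  proof (rule similar_matI[where n = n and P = D and Q = D'])
    show "{A, M, D, D'} \<subseteq> carrier_mat n n" using carr by auto
    show "D * D' = 1\<^sub>m n" "D' * D = 1\<^sub>m n"
      by (rule eq_matI; auto simp: D_def D'_def scalar_prod_def if_distrib[of "\<lambda>x. _ * x"]
          less_imp_neq[OF s(1), symmetric] cong: if_cong)+
    have DM: "D * M = mat n n (\<lambda>(i, j). L (vs ! i) (vs ! j) / s i)"
    proof (rule eq_matI)
      fix i j assume "i < dim_row (mat n n (\<lambda>(i, j). L (vs ! i) (vs ! j) / s i))"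
        "j < dim_col (mat n n (\<lambda>(i, j). L (vs ! i) (vs ! j) / s i))"
      then have ij: "i < n" "j < n" by auto
      then have "(D * M) $$ (i, j) = s i * (inverse (s i * s i) * L (vs ! i) (vs ! j))"
        by (simp add: D_def M_def matrix_of_def len scalar_prod_def if_distrib[of "\<lambda>x. x * _"] s cong: if_cong)
      then show "(D * M) $$ (i, j) = mat n n (\<lambda>(i, j). L (vs ! i) (vs ! j) / s i) $$ (i, j)"
        using ij s(1)[OF ij(1)] by (simp add: field_simps)
    qed (use carr in auto)
    show "A = D * M * D'"
      unfolding DM by (rule eq_matI)
        (auto simp: A_def D'_def scalar_prod_def if_distrib[of "\<lambda>x. _ * x"] cong: if_cong)
  qed
  then have es: "es = sorted_list_of_multiset (proots (char_poly A))"
    unfolding es_def eigenvalues_on_def char_poly_on_eq[OF vs(2,1)] M_def[symmetric]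
    by (simp add: char_poly_similar)
  have symA: "A\<^sup>T = A"
  proof (rule eq_matI)
    fix i j assume "i < dim_row A" "j < dim_col A"
    then have ij: "i < n" "j < n" using carr by auto
    then have "vs ! i \<in> V" "vs ! j \<in> V" using len vs(1) by auto
    then show "A\<^sup>T $$ (i, j) = A $$ (i, j)" using ij sym[of "vs ! i" "vs ! j"]
      by (simp add: A_def mult.commute)
  qed (use carr in auto)
  note diag = orthogonal_diagonalisation_sorted[OF carr(2) symA, folded es]
  show "length es = card V" using diag(1) n_def by simp
  from diag(2) obtain P where P: "(\<forall>i<n. \<forall>j<n. (\<Sum>k<n. P k i * P k j) = (if i = j then 1 else 0)) \<and>
      (\<forall>k<n. \<forall>l<n. (\<Sum>i<n. P k i * P l i) = (if k = l then 1 else 0)) \<and>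
      (\<forall>k<n. \<forall>l<n. A $$ (k, l) = (\<Sum>i<n. P k i * es ! i * P l i))"
    by (rule exE)
  then have PP: "\<And>i j. i < n \<Longrightarrow> j < n \<Longrightarrow> (\<Sum>k<n. P k i * P k j) = (if i = j then 1 else 0)"
    and PP': "\<And>k l. k < n \<Longrightarrow> l < n \<Longrightarrow> (\<Sum>i<n. P k i * P l i) = (if k = l then 1 else 0)"
    and PA: "\<And>k l. k < n \<Longrightarrow> l < n \<Longrightarrow> A $$ (k, l) = (\<Sum>i<n. P k i * es ! i * P l i)"
    by simp_all
  \<comment> \<open>The \<open>i\<close>-th column of \<open>P\<close> divided by \<open>s\<close>, with positions in \<open>vs\<close> translated back to vertices.\<close>
  define b where "b i v = (let k = the_inv_into {..<n} (nth vs) v in P k i / s k)" for i v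
  have bij: "bij_betw (nth vs) {..<n} V" using bij_betw_nth[OF vs(2)] len vs(1) by simp
  have b: "b i (vs ! k) = P k i / s k" if "k < n" for i k
    using that bij unfolding b_def by (simp add: the_inv_into_f_f bij_betw_def)
  have sumV: "(\<Sum>v\<in>V. F v) = (\<Sum>k<n. F (vs ! k))" for F :: "'v \<Rightarrow> real"
    by (rule sum.reindex_bij_betw[OF bij, symmetric])
  have coord: "weighted_inner V \<upsilon> g (b i) = (\<Sum>k<n. (s k * g (vs ! k)) * P k i)" for g i
    unfolding weighted_inner_def sumV
    by (intro sum.cong refl) (auto simp: b s(2)[symmetric] less_imp_neq[OF s(1), symmetric])
  have "weighted_inner V \<upsilon> (b i) (b j) = (if i = j then 1 else 0)" if "i < n" "j < n" for i j
    unfolding coord PP[OF that, symmetric]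
    by (intro sum.cong refl) (auto simp: b less_imp_neq[OF s(1), symmetric])
  moreover have "weighted_inner V \<upsilon> g g = (\<Sum>i<n. (weighted_inner V \<upsilon> g (b i))\<^sup>2)" for g
  proof -
    have "weighted_inner V \<upsilon> g g = (\<Sum>k<n. (s k * g (vs ! k)) * (s k * g (vs ! k)))"
      unfolding weighted_inner_def sumV by (intro sum.cong refl) (simp add: s(2)[symmetric])
    also have "\<dots> = (\<Sum>k<n. \<Sum>l<n. if k = l then (s k * g (vs ! k)) * (s l * g (vs ! l)) else 0)"
      by (intro sum.cong refl) simp
    also have "\<dots> = (\<Sum>k<n. \<Sum>l<n. (s k * g (vs ! k)) * (if k = l then 1 else 0) * (s l * g (vs ! l)))"
      by (intro sum.cong refl) simp
    also have "\<dots> = (\<Sum>i<n. 1 * (\<Sum>k<n. (s k * g (vs ! k)) * P k i)\<^sup>2)"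
      by (rule sum_diagonalised_form) (simp add: PP')
    finally show ?thesis by (simp add: coord)
  qed
  moreover have "quadratic_form V L g = (\<Sum>i<n. es ! i * (weighted_inner V \<upsilon> g (b i))\<^sup>2)" for g
  proof -
    have "quadratic_form V L g
        = (\<Sum>k<n. \<Sum>l<n. (s k * g (vs ! k)) * A $$ (k, l) * (s l * g (vs ! l)))"
      unfolding quadratic_form_def sumV
      by (intro sum.cong refl) (auto simp: A_def less_imp_neq[OF s(1), symmetric])
    also have "\<dots> = (\<Sum>i<n. es ! i * (\<Sum>k<n. (s k * g (vs ! k)) * P k i)\<^sup>2)"
      by (rule sum_diagonalised_form) (simp add: PA)
    finally show ?thesis by (simp add: coord)
  qed
  ultimately show "\<exists>b. eigenbasis V \<upsilon> L es b"
    unfolding n_def eigenbasis_def by (intro exI[of _ b]) simp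
qed

section \<open>Comparison of two spectra\<close>

text \<open>
  Padded with zero rows, the coefficient matrix becomes square and singular, so its kernel is
  nontrivial.
\<close>

lemma ex_nontrivial_solution:
  fixes c :: "nat \<Rightarrow> nat \<Rightarrow> 'a :: field"
  assumes mn: "m < n"
  shows "\<exists>a. (\<exists>j<n. a j \<noteq> 0) \<and> (\<forall>l<m. (\<Sum>j<n. c l j * a j) = 0)"
proof -
  define A where "A = mat n n (\<lambda>(l, j). if l < m then c l j else 0)"
  have A: "A \<in> carrier_mat n n" by (simp add: A_def)
  have "A = mat\<^sub>r n n (\<lambda>i. if i = m then 0\<^sub>v n else row A i)"
    by (rule eq_matI) (auto simp: A_def)
  also have "det \<dots> = 0" using A by (intro det_row_0[OF mn]) auto
  finally have "det A = 0" .
  then obtain v where v: "v \<in> carrier_vec n" "v \<noteq> 0\<^sub>v n" "A *\<^sub>v v = 0\<^sub>v n"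
    using det_0_iff_vec_prod_zero_field[OF A] by auto
  have "\<exists>j<n. v $ j \<noteq> 0" using v(1,2) by (auto intro!: eq_vecI)
  moreover have "(\<Sum>j<n. c l j * v $ j) = 0" if "l < m" for l
    using arg_cong[OF v(3), of "\<lambda>w. w $ l"] that mn v(1)
    by (simp add: A_def scalar_prod_def lessThan_atLeast0)
  ultimately show ?thesis by (intro exI[of _ "\<lambda>j. v $ j"]) blast
qed

text \<open>
  The minimax principle, reduced to the dimension count behind it. The functions \<open>g\<close> spanned by the
  first \<open>i + k + 1\<close> eigenfunctions of \<open>B\<close> satisfy \<open>B(g,g) \<le> fs ! (i + k) * \<langle>g,g\<rangle>\<close>. On this space, the \<open>k\<close>
  constraints \<open>\<phi>\<close> together with orthogonality of the pullback \<open>g \<circ> p\<close> to the first \<open>i\<close> eigenfunctions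
  of \<open>A\<close> are only \<open>i + k\<close> linear conditions, so some \<open>g \<noteq> 0\<close> meets them all. Then
  \<open>es ! i * \<langle>g \<circ> p,g \<circ> p\<rangle> \<le> A(g \<circ> p,g \<circ> p)\<close>, and the hypotheses link the two chains.

  Maps between the two function spaces are restricted to pullbacks, which covers the identity,
  pullback along a contraction, and pullback along a section of it; the constraints
  make room for maps that are isometric only on a subspace, at the price of an index shift.
\<close>

lemma eigenvalue_comparison:
  fixes V :: "'v set" and W :: "'w set" and p :: "'v \<Rightarrow> 'w"
  assumes V: "finite V" "\<And>v. v \<in> V \<Longrightarrow> \<upsilon> v > 0"
      "\<And>u v. u \<in> V \<Longrightarrow> v \<in> V \<Longrightarrow> A u v = A v u"
    and W: "finite W" "\<And>w. w \<in> W \<Longrightarrow> \<omega> w > 0"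
      "\<And>u v. u \<in> W \<Longrightarrow> v \<in> W \<Longrightarrow> B u v = B v u"
    and norm: "\<And>g. (\<And>l. l < k \<Longrightarrow> (\<Sum>w\<in>W. \<phi> l w * g w) = 0) \<Longrightarrow>
      weighted_inner V \<upsilon> (g \<circ> p) (g \<circ> p) = weighted_inner W \<omega> g g"
    and form: "\<And>g. (\<And>l. l < k \<Longrightarrow> (\<Sum>w\<in>W. \<phi> l w * g w) = 0) \<Longrightarrow>
      quadratic_form V A (g \<circ> p) \<le> quadratic_form W B g"
    and i: "i < card V" "i + k < card W"
  shows "eigenvalues_on V (\<lambda>u v. inverse (\<upsilon> u) * A u v) ! i
    \<le> eigenvalues_on W (\<lambda>u v. inverse (\<omega> u) * B u v) ! (i + k)"
proof -
  define es where "es = eigenvalues_on V (\<lambda>u v. inverse (\<upsilon> u) * A u v)"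
  define fs where "fs = eigenvalues_on W (\<lambda>u v. inverse (\<omega> u) * B u v)"
  define m where "m = i + k"
  have lenV: "length es = card V" unfolding es_def by (rule eigenbasis_weighted(1)[OF V])
  have lenW: "length fs = card W" unfolding fs_def by (rule eigenbasis_weighted(1)[OF W])
  have sorted: "sorted es" "sorted fs"
    unfolding es_def fs_def eigenvalues_on_def by simp_all
  have "\<exists>a. eigenbasis V \<upsilon> A es a" unfolding es_def by (rule eigenbasis_weighted(2)[OF V])
  then obtain a where "eigenbasis V \<upsilon> A es a" ..
  then have aN: "\<And>g. weighted_inner V \<upsilon> g g = (\<Sum>i<card V. (weighted_inner V \<upsilon> g (a i))\<^sup>2)"
    and aQ: "\<And>g. quadratic_form V A g = (\<Sum>i<card V. es ! i * (weighted_inner V \<upsilon> g (a i))\<^sup>2)"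
    by (simp_all add: eigenbasis_def)
  have "\<exists>b. eigenbasis W \<omega> B fs b" unfolding fs_def by (rule eigenbasis_weighted(2)[OF W])
  then obtain b where "eigenbasis W \<omega> B fs b" ..
  then have borth: "\<And>i j. i < card W \<Longrightarrow> j < card W \<Longrightarrow>
      weighted_inner W \<omega> (b i) (b j) = (if i = j then 1 else 0)"
    and bN: "\<And>g. weighted_inner W \<omega> g g = (\<Sum>i<card W. (weighted_inner W \<omega> g (b i))\<^sup>2)"
    and bQ: "\<And>g. quadratic_form W B g = (\<Sum>i<card W. fs ! i * (weighted_inner W \<omega> g (b i))\<^sup>2)"
    by (simp_all add: eigenbasis_def)
  \<comment> \<open>The \<open>i + k\<close> conditions, evaluated on the \<open>j\<close>-th eigenfunction of \<open>B\<close>.\<close>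
  define c where "c l j = (if l < i then weighted_inner V \<upsilon> (b j \<circ> p) (a l)
    else \<Sum>w\<in>W. \<phi> (l - i) w * b j w)" for l j
  obtain t where t: "\<exists>j<Suc m. t j \<noteq> 0" "\<And>l. l < m \<Longrightarrow> (\<Sum>j<Suc m. c l j * t j) = 0"
    using ex_nontrivial_solution[of m "Suc m" c] by auto
  define g where "g w = (\<Sum>j<Suc m. t j * b j w)" for w
  have kill: "(\<Sum>w\<in>W. \<phi> l w * g w) = 0" if "l < k" for l
  proof -
    have "(\<Sum>w\<in>W. \<phi> l w * g w) = (\<Sum>w\<in>W. \<Sum>j<Suc m. (\<phi> l w * b j w) * t j)"
      unfolding g_def sum_distrib_left by (intro sum.cong refl) simp
    also have "\<dots> = (\<Sum>j<Suc m. \<Sum>w\<in>W. (\<phi> l w * b j w) * t j)" by (rule sum.swap)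
    also have "\<dots> = (\<Sum>j<Suc m. c (i + l) j * t j)" 
      by (simp add: c_def sum_distrib_right del: sum.lessThan_Suc)
    finally show ?thesis using t(2)[of "i + l"] that unfolding m_def by simp
  qed
  have low: "weighted_inner V \<upsilon> (g \<circ> p) (a l) = 0" if "l < i" for l
  proof -
    have "weighted_inner V \<upsilon> (g \<circ> p) (a l)
        = (\<Sum>v\<in>V. \<Sum>j<Suc m. (\<upsilon> v * b j (p v) * a l v) * t j)"
      unfolding weighted_inner_def g_def o_def sum_distrib_left sum_distrib_right
      by (intro sum.cong refl) simp
    also have "\<dots> = (\<Sum>j<Suc m. \<Sum>v\<in>V. (\<upsilon> v * b j (p v) * a l v) * t j)" by (rule sum.swap)
    also have "\<dots> = (\<Sum>j<Suc m. c l j * t j)"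
      using that by (simp add: c_def sum_distrib_right weighted_inner_def del: sum.lessThan_Suc)
    finally show ?thesis using t(2)[of l] that unfolding m_def by simp
  qed
  have coord: "weighted_inner W \<omega> g (b q) = (if q < Suc m then t q else 0)" if "q < card W" for q
  proof -
    have "weighted_inner W \<omega> g (b q) = (\<Sum>w\<in>W. \<Sum>j<Suc m. t j * (\<omega> w * b j w * b q w))"
      unfolding weighted_inner_def g_def o_def sum_distrib_left sum_distrib_right
      by (intro sum.cong refl) simp
    also have "\<dots> = (\<Sum>j<Suc m. \<Sum>w\<in>W. t j * (\<omega> w * b j w * b q w))" by (rule sum.swap)
    also have "\<dots> = (\<Sum>j<Suc m. t j * weighted_inner W \<omega> (b j) (b q))"
      by (simp only: weighted_inner_def sum_distrib_left)
    also have "\<dots> = (\<Sum>j<Suc m. if j = q then t j else 0)"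
      using that i(2) by (intro sum.cong refl) (auto simp: borth m_def)
    finally show ?thesis by simp
  qed
  define N where "N = weighted_inner W \<omega> g g"
  have Npos: "N > 0"
  proof -
    obtain j where j: "j < Suc m" "t j \<noteq> 0" using t(1) by blast
    then have jW: "j < card W" using i(2) m_def by simp
    have "0 < (weighted_inner W \<omega> g (b j))\<^sup>2" using j coord[OF jW] by simp
    also have "\<dots> \<le> N" unfolding N_def bN[of g] using jW by (intro member_le_sum) auto
    finally show ?thesis .
  qed
  have normg: "weighted_inner V \<upsilon> (g \<circ> p) (g \<circ> p) = N"
    unfolding N_def by (rule norm) (rule kill)
  have "es ! i * N = (\<Sum>l<card V. es ! i * (weighted_inner V \<upsilon> (g \<circ> p) (a l))\<^sup>2)"
    unfolding normg[symmetric] aN[of "g \<circ> p"] by (simp add: sum_distrib_left)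
  also have "\<dots> \<le> quadratic_form V A (g \<circ> p)"
    unfolding aQ
  proof (intro sum_mono)
    fix l assume "l \<in> {..<card V}"
    then show "es ! i * (weighted_inner V \<upsilon> (g \<circ> p) (a l))\<^sup>2
        \<le> es ! l * (weighted_inner V \<upsilon> (g \<circ> p) (a l))\<^sup>2"
      using low[of l] sorted_nth_mono[OF sorted(1), of i l] lenV
      by (cases "l < i") (auto intro!: mult_right_mono)
  qed
  also have "\<dots> \<le> quadratic_form W B g" by (rule form) (rule kill)
  also have "\<dots> \<le> (\<Sum>l<card W. fs ! m * (weighted_inner W \<omega> g (b l))\<^sup>2)"
    unfolding bQ
  proof (intro sum_mono)
    fix l assume "l \<in> {..<card W}"
    then show "fs ! l * (weighted_inner W \<omega> g (b l))\<^sup>2 \<le> fs ! m * (weighted_inner W \<omega> g (b l))\<^sup>2"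
      using coord[of l] sorted_nth_mono[OF sorted(2), of l m] lenW i(2) m_def
      by (cases "l < Suc m") (auto intro!: mult_right_mono)
  qed
  also have "\<dots> = fs ! m * N" unfolding N_def bN[of g] by (simp add: sum_distrib_left)
  finally have "es ! i \<le> fs ! m" using Npos by simp
  then show ?thesis by (simp add: es_def fs_def m_def)
qed

section \<open>The quadratic form of the Laplacian\<close>

lemma edge_weight_commute: "edge_weight G \<epsilon> u v = edge_weight G \<epsilon> v u"
  proof -
  have "Upair u v = Upair v u" by simp
  then show ?thesis unfolding edge_weight_def by (simp only: eq_commute[of u v])
qed

lemma laplacian_commute: "laplacian G \<epsilon> u v = laplacian G \<epsilon> v u"
  by (simp add: laplacian_def edge_weight_commute[of G \<epsilon> u v])

text \<open>
  The Laplacian form is the weighted sum of squared differences along edges. A loop contributes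
  nothing: in the Laplacian its weight enters the degree and the diagonal of the
  adjacency matrix equally. The functions \<open>x\<close> and \<open>y\<close> choose an orientation of each edge, which the
  square makes irrelevant.
\<close>

lemma quadratic_form_laplacian:
  assumes finV: "finite (verts G)" and finE: "finite (edges G)"
    and ends: "\<And>f. f \<in> edges G \<Longrightarrow> x f \<in> verts G \<and> y f \<in> verts G \<and> ends G f = Upair (x f) (y f)"
  shows "quadratic_form (verts G) (laplacian G \<epsilon>) g = (\<Sum>f\<in>edges G. \<epsilon> f * (g (x f) - g (y f))\<^sup>2)"
proof -
  let ?V = "verts G" and ?E = "edges G" and ?w = "edge_weight G \<epsilon>"
  have "quadratic_form ?V (laplacian G \<epsilon>) g = (\<Sum>u\<in>?V. \<Sum>v\<in>?V. ?w u v * (g u * g u - g u * g v))"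
  proof -
    have "(\<Sum>v\<in>?V. g u * laplacian G \<epsilon> u v * g v) = (\<Sum>v\<in>?V. ?w u v * (g u * g u - g u * g v))"
      if u: "u \<in> ?V" for u
    proof -
      have "(\<Sum>v\<in>?V. g u * laplacian G \<epsilon> u v * g v)
          = (\<Sum>v\<in>?V. (if u = v then g u * degree_weight G \<epsilon> u * g u else 0) - g u * ?w u v * g v)"
        by (intro sum.cong refl) (auto simp: laplacian_def algebra_simps)
      also have "\<dots> = g u * degree_weight G \<epsilon> u * g u - (\<Sum>v\<in>?V. g u * ?w u v * g v)"
        using u finV by (simp add: sum_subtractf)
      also have "\<dots> = (\<Sum>v\<in>?V. g u * ?w u v * g u) - (\<Sum>v\<in>?V. g u * ?w u v * g v)"
        by (simp only: degree_weight_def sum_distrib_left sum_distrib_right)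
      also have "\<dots> = (\<Sum>v\<in>?V. ?w u v * (g u * g u - g u * g v))"
        unfolding sum_subtractf[symmetric] by (intro sum.cong refl) (simp add: algebra_simps)
      finally show ?thesis .
    qed
    then show ?thesis unfolding quadratic_form_def by (rule sum.cong[OF refl])
  qed
  \<comment> \<open>The weights are symmetric; adding the two expressions completes the square.\<close>
  moreover have "\<dots> = (\<Sum>u\<in>?V. \<Sum>v\<in>?V. ?w u v * (g v * g v - g u * g v))"
    by (subst sum.swap) (intro sum.cong refl, simp add: edge_weight_commute mult.commute)
  ultimately have "2 * quadratic_form ?V (laplacian G \<epsilon>) g
      = (\<Sum>u\<in>?V. \<Sum>v\<in>?V. ?w u v * (g u * g u - g u * g v))
        + (\<Sum>u\<in>?V. \<Sum>v\<in>?V. ?w u v * (g v * g v - g u * g v))"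
    by linarith
  also have "\<dots> = (\<Sum>u\<in>?V. \<Sum>v\<in>?V. ?w u v * (g u - g v)\<^sup>2)"
    unfolding sum.distrib[symmetric]
    by (intro sum.cong refl) (simp add: algebra_simps power2_eq_square)
  also have "\<dots> = (\<Sum>u\<in>?V. \<Sum>v\<in>?V. \<Sum>f\<in>?E. if ends G f = Upair u v then \<epsilon> f * (g u - g v)\<^sup>2 else 0)"
  proof (intro sum.cong refl)
    fix u v
    have "?w u v * (g u - g v)\<^sup>2 = (\<Sum>f\<in>{f \<in> ?E. ends G f = Upair u v}. \<epsilon> f * (g u - g v)\<^sup>2)"
      by (cases "u = v") (simp_all add: edge_weight_def sum_distrib_right)
    also have "\<dots> = (\<Sum>f\<in>?E. if ends G f = Upair u v then \<epsilon> f * (g u - g v)\<^sup>2 else 0)"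
      by (rule sum.inter_filter[OF finE])
    finally show "?w u v * (g u - g v)\<^sup>2
        = (\<Sum>f\<in>?E. if ends G f = Upair u v then \<epsilon> f * (g u - g v)\<^sup>2 else 0)" .
  qed
  also have "\<dots> = (\<Sum>u\<in>?V. \<Sum>f\<in>?E. \<Sum>v\<in>?V. if ends G f = Upair u v then \<epsilon> f * (g u - g v)\<^sup>2 else 0)"
    by (intro sum.cong refl sum.swap)
  also have "\<dots> = (\<Sum>f\<in>?E. \<Sum>u\<in>?V. \<Sum>v\<in>?V. if ends G f = Upair u v then \<epsilon> f * (g u - g v)\<^sup>2 else 0)"
    by (rule sum.swap)
  also have "\<dots> = (\<Sum>f\<in>?E. 2 * (\<epsilon> f * (g (x f) - g (y f))\<^sup>2))"
  proof (intro sum.cong refl)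
    fix f assume f: "f \<in> ?E"
    define d where "d = \<epsilon> f * (g (x f) - g (y f))\<^sup>2"
    have xy: "x f \<in> ?V" "y f \<in> ?V" "ends G f = Upair (x f) (y f)" using ends[OF f] by auto
    have "(\<Sum>u\<in>?V. \<Sum>v\<in>?V. if ends G f = Upair u v then \<epsilon> f * (g u - g v)\<^sup>2 else 0)
        = (\<Sum>u\<in>?V. \<Sum>v\<in>?V. (if v = y f then if u = x f then d else 0 else 0)
            + (if v = x f then if u = y f then d else 0 else 0))"
      by (intro sum.cong refl) (auto simp: xy(3) d_def power2_commute)
    also have "\<dots> = 2 * d"
      using xy(1,2) finV by (simp add: sum.distrib)
    finally show "(\<Sum>u\<in>?V. \<Sum>v\<in>?V. if ends G f = Upair u v then \<epsilon> f * (g u - g v)\<^sup>2 else 0)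
        = 2 * (\<epsilon> f * (g (x f) - g (y f))\<^sup>2)" unfolding d_def .
  qed
  finally show ?thesis by (simp add: sum_distrib_left[symmetric])
qed

section \<open>Interlacing under deletion and contraction\<close>

theorem theorem5p4:
  fixes G :: "('v, 'e) pre_multigraph"
    and \<upsilon> :: "'v \<Rightarrow> real" and \<epsilon> :: "'e \<Rightarrow> real"
    and e :: 'e and n :: nat
    and lam mu nu :: "real list"
  assumes "weighted_multigraph G \<upsilon> \<epsilon>"
    and "card (verts G) = n"
    and "nonloop_edge G e"
    and "lam = laplacian_eigenvalues G \<upsilon> \<epsilon>"
    and "mu = laplacian_eigenvalues (delete_edge G e) \<upsilon> \<epsilon>"
    and "nu = laplacian_eigenvalues (contract_edge G e) (contract_weight \<upsilon>) \<epsilon>"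
  shows "length lam = n \<and> length mu = n \<and> length nu = n - 1 \<and>
    (\<forall>i < n. mu ! i \<le> lam ! i) \<and>
    (\<forall>i < n - 1. lam ! i \<le> nu ! i \<and> nu ! i \<le> mu ! (i + 1))"
proof -
  define V where "V = verts G"
  define E where "E = edges G"
  define D where "D = delete_edge G e"
  define H where "H = contract_edge G e"
  define W where "W = verts H"
  define c where "c = contract_vertex G e"
  have vertsD: "verts D = V" and edgesD: "edges D = E - {e}" and endsD: "ends D = ends G"
    by (simp_all add: D_def delete_edge_def V_def E_def)
  have W: "W = c ` V" and edgesH: "edges H = E - {e}" and endsH: "\<And>f. ends H f = map_uprod c (ends G f)"
    by (simp_all add: W_def H_def contract_edge_def c_def V_def E_def)
  have finV: "finite V" and finE: "finite E" and pos: "\<And>v. v \<in> V \<Longrightarrow> \<upsilon> v > 0"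
    and epos: "\<And>f. f \<in> E \<Longrightarrow> \<epsilon> f > 0"
    and inc: "\<And>f. f \<in> E \<Longrightarrow> set_uprod (ends G f) \<subseteq> V"
    using assms(1) unfolding weighted_multigraph_def multigraph_def V_def E_def by auto
  have finW: "finite W" using finV W by simp
  have eE: "e \<in> E" and proper: "proper_uprod (ends G e)"
    using assms(3) unfolding nonloop_edge_def E_def by auto
  have "\<exists>x y. ends G f = Upair x y" for f by (cases "ends G f") auto
  then obtain x y where xy: "\<And>f. ends G f = Upair (x f) (y f)" by metis
  have xyV: "x f \<in> V" "y f \<in> V" if "f \<in> E" for f using inc[OF that] xy[of f] by auto
  define a where "a = x e"
  define b where "b = y e"
  have ab: "a \<noteq> b" "a \<in> V" "b \<in> V" using proper xy[of e] xyV[OF eE] unfolding a_def b_def by auto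
  have c: "c w = (if w = a \<or> w = b then {a, b} else {w})" for w
    unfolding c_def contract_vertex_def xy[of e] a_def[symmetric] b_def[symmetric] by auto

  \<comment> \<open>Each of the three forms is a sum over its edges; only \<open>e\<close> distinguishes \<open>G\<close> from \<open>G - e\<close>, and pulling
    back along the contraction turns the form of \<open>G / e\<close> into that of \<open>G - e\<close>.\<close>
  have formG: "quadratic_form V (laplacian G \<epsilon>) g = (\<Sum>f\<in>E. \<epsilon> f * (g (x f) - g (y f))\<^sup>2)" for g
    unfolding V_def E_def
    by (rule quadratic_form_laplacian) (use finV finE xy xyV in \<open>auto simp: V_def E_def\<close>)
  have formD: "quadratic_form V (laplacian D \<epsilon>) g = (\<Sum>f\<in>E - {e}. \<epsilon> f * (g (x f) - g (y f))\<^sup>2)" for g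
    unfolding vertsD[symmetric] edgesD[symmetric]
    by (rule quadratic_form_laplacian) (use finV finE xy xyV in \<open>auto simp: vertsD edgesD endsD\<close>)
  have formH: "quadratic_form W (laplacian H \<epsilon>) h = (\<Sum>f\<in>E - {e}. \<epsilon> f * (h (c (x f)) - h (c (y f)))\<^sup>2)" for h
    unfolding W_def edgesH[symmetric]
    by (rule quadratic_form_laplacian)
      (use finW finE xy xyV in \<open>auto simp: W_def[symmetric] edgesH endsH W\<close>)
  have formG': "quadratic_form V (laplacian G \<epsilon>) g
      = \<epsilon> e * (g a - g b)\<^sup>2 + quadratic_form V (laplacian D \<epsilon>) g" for g
    unfolding formG formD a_def b_def by (rule sum.remove[OF finE eE])
  have formHc: "quadratic_form W (laplacian H \<epsilon>) h = quadratic_form V (laplacian D \<epsilon>) (h \<circ> c)" for h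
    unfolding formH formD by simp
  have fibre: "{v \<in> V. c v = w} = w" if "w \<in> W" for w
    using that ab unfolding W c by (auto split: if_splits)
  have weightH: "contract_weight \<upsilon> w = (\<Sum>v\<in>{v \<in> V. c v = w}. \<upsilon> v)" if "w \<in> W" for w
    unfolding contract_weight_def fibre[OF that] ..
  \<comment> \<open>Adding up the vertex weights over each class is what makes this pullback isometric.\<close>
  have normHc: "weighted_inner W (contract_weight \<upsilon>) h h = weighted_inner V \<upsilon> (h \<circ> c) (h \<circ> c)" for h
  proof -
    have "weighted_inner V \<upsilon> (h \<circ> c) (h \<circ> c)
        = (\<Sum>w\<in>W. \<Sum>v\<in>{v \<in> V. c v = w}. \<upsilon> v * (h \<circ> c) v * (h \<circ> c) v)"
      unfolding weighted_inner_def by (rule sum.group[symmetric]) (use finV finW W in auto)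
    also have "\<dots> = (\<Sum>w\<in>W. contract_weight \<upsilon> w * h w * h w)"
      by (intro sum.cong refl) (simp add: weightH sum_distrib_right)
    finally show ?thesis unfolding weighted_inner_def by simp
  qed
  have posH: "contract_weight \<upsilon> w > 0" if "w \<in> W" for w
    unfolding weightH[OF that] using that pos finV unfolding W by (intro sum_pos) auto
  have cardW: "card W = n - 1"
  proof -
    have "W = insert {a, b} ((\<lambda>v. {v}) ` (V - {a, b}))" unfolding W c using ab by auto
    moreover have "{a, b} \<notin> (\<lambda>v. {v}) ` (V - {a, b})" using ab by auto
    ultimately have "card W = Suc (card (V - {a, b}))"
      using finV by (simp add: card_image)
    moreover have "card (V - {a, b}) = n - 2" "n \<ge> 2"
      using ab assms(2) finV card_mono[of V "{a, b}"] by (auto simp: V_def[symmetric] card_Diff_subset)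
    ultimately show ?thesis by simp
  qed
  \<comment> \<open>A section of the contraction. For \<open>g\<close> with \<open>g a = g b\<close> it is immaterial which end of \<open>e\<close> represents the
    new vertex, so \<open>g \<circ> r\<close> is the function on \<open>G / e\<close> that pulls back to \<open>g\<close>.\<close>
  define r where "r w = (SOME v. v \<in> V \<and> c v = w)" for w
  have r: "r w \<in> V \<and> c (r w) = w" if "w \<in> W" for w
    unfolding r_def by (rule someI_ex) (use that W in auto)
  have cV: "c v \<in> W" if "v \<in> V" for v using that W by simp
  have rc: "g (r (c v)) = g v" if "v \<in> V" "g a = g b" for g :: "'v \<Rightarrow> real" and v
    using r[OF cV[OF that(1)]] that(2) unfolding c by (auto split: if_splits simp: doubleton_eq_iff)

  have lam: "lam = eigenvalues_on V (\<lambda>u v. inverse (\<upsilon> u) * laplacian G \<epsilon> u v)"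
    and mu: "mu = eigenvalues_on V (\<lambda>u v. inverse (\<upsilon> u) * laplacian D \<epsilon> u v)"
    and nu: "nu = eigenvalues_on W (\<lambda>u v. inverse (contract_weight \<upsilon> u) * laplacian H \<epsilon> u v)"
    unfolding assms(4-6) laplacian_eigenvalues_def weighted_laplacian_def D_def[symmetric]
      H_def[symmetric] vertsD V_def[symmetric] W_def[symmetric] by simp_all
  have cardV: "card V = n" using assms(2) V_def by simp
  have lengths: "length lam = n" "length mu = n" "length nu = n - 1"
    unfolding lam mu nu cardV[symmetric] cardW[symmetric, unfolded cardV[symmetric]]
    using eigenbasis_weighted(1)[OF finV pos laplacian_commute]
      eigenbasis_weighted(1)[OF finW posH laplacian_commute] cardW cardV by auto

  \<comment> \<open>Deleting \<open>e\<close> drops a nonnegative term from the form.\<close>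
  have "mu ! i \<le> lam ! i" if "i < n" for i
  proof -
    have "mu ! i \<le> lam ! (i + 0)"
      unfolding mu lam
    proof (rule eigenvalue_comparison[where k = 0 and p = id and \<phi> = "\<lambda>_ _. 0"])
      fix g :: "'v \<Rightarrow> real"
      have "\<epsilon> e * (g a - g b)\<^sup>2 \<ge> 0" using epos[OF eE] by simp
      then show "quadratic_form V (laplacian D \<epsilon>) (g \<circ> id) \<le> quadratic_form V (laplacian G \<epsilon>) g"
        unfolding formG' by simp
    qed (use finV pos laplacian_commute that cardV in auto)
    then show ?thesis by simp
  qed
  \<comment> \<open>Pullbacks along the contraction agree at the ends of \<open>e\<close>, where the term of \<open>e\<close> vanishes.\<close>
  moreover have "lam ! i \<le> nu ! i" if "i < n - 1" for i
  proof -
    have "lam ! i \<le> nu ! (i + 0)"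
      unfolding lam nu
    proof (rule eigenvalue_comparison[where k = 0 and p = c and \<phi> = "\<lambda>_ _. 0"])
      fix h :: "'v set \<Rightarrow> real"
      have "c a = c b" by (simp add: c)
      then show "quadratic_form V (laplacian G \<epsilon>) (h \<circ> c) \<le> quadratic_form W (laplacian H \<epsilon>) h"
        unfolding formG' formHc by simp
    qed (use finV finW pos posH laplacian_commute that cardV cardW normHc in auto)
    then show ?thesis by simp
  qed
  \<comment> \<open>The single constraint \<open>g a = g b\<close> costs one index.\<close>
  moreover have "nu ! i \<le> mu ! (i + 1)" if "i < n - 1" for i
    unfolding nu mu
  proof (rule eigenvalue_comparison[where p = r
        and \<phi> = "\<lambda>_ v. (if v = a then 1 else 0) - (if v = b then 1 else 0)"])
    fix g :: "'v \<Rightarrow> real"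
    assume "\<And>l. l < (1::nat) \<Longrightarrow> (\<Sum>v\<in>V. ((if v = a then 1 else 0) - (if v = b then 1 else 0)) * g v) = 0"
    then have "(\<Sum>v\<in>V. ((if v = a then 1 else 0) - (if v = b then 1 else 0)) * g v) = 0" by simp
    moreover have "(\<Sum>v\<in>V. ((if v = a then 1 else 0) - (if v = b then 1 else 0)) * g v)
        = (\<Sum>v\<in>V. (if v = a then g v else 0) - (if v = b then g v else 0))"
      by (intro sum.cong refl) simp
    ultimately have gab: "g a = g b" using ab finV by (simp add: sum_subtractf)
    show "weighted_inner W (contract_weight \<upsilon>) (g \<circ> r) (g \<circ> r) = weighted_inner V \<upsilon> g g"
      unfolding normHc unfolding weighted_inner_def by (intro sum.cong refl) (simp add: rc gab)
    show "quadratic_form W (laplacian H \<epsilon>) (g \<circ> r) \<le> quadratic_form V (laplacian D \<epsilon>) g"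
      unfolding formH formD
      by (intro sum_mono) (simp add: rc[OF xyV(1) gab] rc[OF xyV(2) gab])
  qed (use finV finW pos posH laplacian_commute that cardV cardW in auto)
  ultimately show ?thesis using lengths by blast
qed

end
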